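(* Let $R$ be a Euclidean domain, $\mathbf F=(F_1,\dots,F_n)$ with $F_i\in R[x_1,\dots,x_n]$, $u=\sum_{i=1}^n\lambda_ix_i$ with $\lambda_i\in R$, and let $q(T)\in R[T]$ and $\mathbf v(T)=(v_1(T),\dots,v_n(T))\in R[T]^n$ satisfy conditions (1)–(6) of the context. Let $\Lambda(T)$, $\bar{\mathbf V}(T)$, $\bar Q(T)$ and $J_\Phi$ be as in the context. Then $\Lambda(T)$ is invertible modulo $q(T)$, and thus $\bar{\mathbf V}(T)$ and $\bar Q(T)$ are well defined. Furthermore, $$\begin{bmatrix}\bar{\mathbf V}(T)\\ \bar Q(T)-T^d\end{bmatrix}=\begin{bmatrix}\mathbf v(T)\\ q(T)-T^d\end{bmatrix}-J_\Phi^{-1}\cdot\begin{bmatrix}\mathbf F(\mathbf v(T))\\ \sum_{i=1}^n\lambda_iv_i(T)-T\end{bmatrix}\bmod q(T),$$ where the vector multiplied by $J_\Phi^{-1}$ on the right hand side is (modulo $q(T)$) $\Phi(\mathbf v(T),q(T)-T^d)$. Finally, $\sum_{i=1}^n\lambda_i\bar V_i(T)=T$.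
   Context: "$p\bmod q$" is the remainder of $p$ on division by the monic polynomial $q$; inverses and fractions are taken in $R[T]/\langle q(T)\rangle$. Map $\Phi$: with $\Delta q(T):=q(T)-T^d$, $\Phi(\mathbf v(T),\Delta q(T)):=\left(F_1(\mathbf v(T))\bmod q(T),\dots,F_n(\mathbf v(T))\bmod q(T),\ \sum_{i=1}^n\lambda_iv_i(T)-T\right)$. For $i=1,\dots,n$ let $m_i(T)$ be the quotient in the division of $F_i(\mathbf v(T))$ by $q(T)$. The Jacobian of $\Phi$ as a map on $(R[T]/\langle q(T)\rangle)^{n+1}$ is $$J_\Phi:=\begin{bmatrix} & & & -m_1(T)\\ & J_{\mathbf F}(\mathbf v(T)) & & \vdots\\ & & & -m_n(T)\\ \lambda_1&\cdots&\lambda_n&0\end{bmatrix}\bmod q(T),\qquad J_{\mathbf F}(\mathbf v(T)):=\left[\tfrac{\partial F_i}{\partial x_j}(\mathbf v(T))\right]_{i,j=1}^n.$$ Conditions: (1) $q(T)$ is monic of degree $d$; (2) each $v_i(T)$ has degree at most $d-1$; (3) $\frac{\partial q(T)}{\partial T}$ is invertible modulo $q(T)$; (4) $\lambda_1v_1(T)+\cdots+\lambda_nv_n(T)=T$; (5) $J_{\mathbf F}(\mathbf v(T))$ is invertible modulo $q(T)$; (6) $J_\Phi$ is invertible modulo $q(T)$. Construction: $\mathbf w(T):=\mathbf v(T)-\left(J_{\mathbf F}(\mathbf v(T))^{-1}\mathbf F(\mathbf v(T))\bmod q(T)\right)$; $\Delta(T):=\sum_{i=1}^n\lambda_iw_i(T)-T$;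 $\mathbf r(T):=\mathbf F(\mathbf v(T))\bmod q(T)$; $\mathbf U(T)=(U_1,\dots,U_n):=\frac{\partial\mathbf v(T)}{\partial T}-\left(J_{\mathbf F}(\mathbf v(T))^{-1}\frac{\partial\mathbf r(T)}{\partial T}\bmod q(T)\right)$; $\Lambda(T):=\sum_{i=1}^n\lambda_iU_i(T)$; $\bar{\mathbf V}(T)=(\bar V_1,\dots,\bar V_n):=\mathbf w(T)-\left(\frac{\Delta(T)}{\Lambda(T)}\mathbf U(T)\bmod q(T)\right)$; $\bar Q(T):=q(T)-\left(\frac{\Delta(T)}{\Lambda(T)}\frac{\partial q(T)}{\partial T}\bmod q(T)\right)$. *)

theory Defs
  imports
    "Jordan_Normal_Form.Matrix"
    "HOL-Computational_Algebra.Polynomial"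
    "HOL-Library.Poly_Mapping"
begin

text \<open>
  Multivariate polynomials over \<open>'a\<close> are finitely supported maps from monomials to
  coefficients, a monomial being a finitely supported exponent map.  The variables
  \<open>x\<^sub>1, \<dots>, x\<^sub>n\<close> are indexed by \<open>0, \<dots>, n - 1\<close>.
\<close>

type_synonym 'a mpoly = "(nat \<Rightarrow>\<^sub>0 nat) \<Rightarrow>\<^sub>0 'a"

definition mpoly_vars :: "'a::zero mpoly \<Rightarrow> nat set" where
  "mpoly_vars f = (\<Union>m\<in>Poly_Mapping.keys f. Poly_Mapping.keys m)"

definition mpoly_eval :: "'a::comm_ring_1 mpoly \<Rightarrow> 'a poly vec \<Rightarrow> 'a poly" where
  "mpoly_eval f v =
     (\<Sum>m\<in>Poly_Mapping.keys f. smult (Poly_Mapping.lookup f m)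
        (\<Prod>i\<in>Poly_Mapping.keys m. (v $ i) ^ Poly_Mapping.lookup m i))"

text \<open>
  In the following definition the subtraction of exponents is truncated; it truncates only when
  the exponent of \<open>x\<^sub>j\<close> is zero, and then the coefficient vanishes.
\<close>

definition mpoly_pderiv :: "nat \<Rightarrow> 'a::comm_ring_1 mpoly \<Rightarrow> 'a mpoly" where
  "mpoly_pderiv j f =
     (\<Sum>m\<in>Poly_Mapping.keys f. Poly_Mapping.single (m - Poly_Mapping.single j 1)
        (of_nat (Poly_Mapping.lookup m j) * Poly_Mapping.lookup f m))"


text \<open>
  The operations \<open>div\<close> and \<open>mod\<close> on polynomials need field coefficients.  For a
  \<^emph>\<open>monic\<close> divisor, over any domain, pseudo-division is division with remainder (the leading
  coefficient power by which it scales the dividend is 1); see \<open>pquo_prem\<close> and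
  \<open>prem_unique\<close> below.
\<close>

definition pquo :: "'a::idom poly \<Rightarrow> 'a poly \<Rightarrow> 'a poly" where
  "pquo p q = fst (pseudo_divmod p q)"

definition prem :: "'a::idom poly \<Rightarrow> 'a poly \<Rightarrow> 'a poly" where
  "prem p q = pseudo_mod p q"

definition vec_rem :: "'a::idom poly vec \<Rightarrow> 'a poly \<Rightarrow> 'a poly vec" where
  "vec_rem v q = map_vec (\<lambda>p. prem p q) v"

definition mat_rem :: "'a::idom poly mat \<Rightarrow> 'a poly \<Rightarrow> 'a poly mat" where
  "mat_rem A q = map_mat (\<lambda>p. prem p q) A"

text \<open>
  Elements of \<open>R[T]/\<langle>q\<rangle>\<close>, for monic \<open>q\<close>, are represented by their remainders:
  \<open>a\<close> and \<open>b\<close> are congruent iff \<open>prem a q = prem b q\<close> (lemma \<open>prem_eq_iff\<close>), and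
  \<open>c\<close> is the canonical representative of its class iff \<open>prem c q = c\<close>.
\<close>

definition invertible_mod :: "'a::idom poly \<Rightarrow> 'a poly \<Rightarrow> bool" where
  "invertible_mod q p \<longleftrightarrow> (\<exists>s. prem (p * s) q = prem 1 q)"

definition frac_mod :: "'a::idom poly \<Rightarrow> 'a poly \<Rightarrow> 'a poly \<Rightarrow> 'a poly" where
  "frac_mod q a b = (THE c. prem c q = c \<and> prem (c * b) q = prem a q)"

definition is_mat_inverse_mod :: "'a::idom poly \<Rightarrow> 'a poly mat \<Rightarrow> 'a poly mat \<Rightarrow> bool" where
  "is_mat_inverse_mod q A B \<longleftrightarrow>
     A \<in> carrier_mat (dim_row A) (dim_row A) \<and> B \<in> carrier_mat (dim_row A) (dim_row A) \<and>
     mat_rem (A * B) q = mat_rem (1\<^sub>m (dim_row A)) q \<and>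
     mat_rem (B * A) q = mat_rem (1\<^sub>m (dim_row A)) q"

definition invertible_mat_mod :: "'a::idom poly \<Rightarrow> 'a poly mat \<Rightarrow> bool" where
  "invertible_mat_mod q A \<longleftrightarrow> (\<exists>B. is_mat_inverse_mod q A B)"

definition mat_inverse_mod :: "'a::idom poly \<Rightarrow> 'a poly mat \<Rightarrow> 'a poly mat" where
  "mat_inverse_mod q A = (THE B. mat_rem B q = B \<and> is_mat_inverse_mod q A B)"


definition lincomb_poly :: "'a::idom vec \<Rightarrow> 'a poly vec \<Rightarrow> 'a poly" where
  "lincomb_poly lam p = (\<Sum>i<dim_vec lam. smult (lam $ i) (p $ i))"

abbreviation var_T :: "'a::idom poly" where
  "var_T \<equiv> [:0, 1:]"

definition sys_eval :: "'a::idom mpoly vec \<Rightarrow> 'a poly vec \<Rightarrow> 'a poly vec" where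
  "sys_eval F v = map_vec (\<lambda>f. mpoly_eval f v) F"

definition jac :: "'a::idom mpoly vec \<Rightarrow> 'a poly vec \<Rightarrow> 'a poly mat" where
  "jac F v = mat (dim_vec F) (dim_vec F) (\<lambda>(i, j). mpoly_eval (mpoly_pderiv j (F $ i)) v)"

text \<open>The second argument is \<open>\<Delta>q = q - T\<^sup>d\<close>, so that the modulus is \<open>T\<^sup>d + \<Delta>q\<close>.\<close>

definition Phi ::
  "nat \<Rightarrow> 'a::idom mpoly vec \<Rightarrow> 'a vec \<Rightarrow> 'a poly vec \<times> 'a poly \<Rightarrow> 'a poly vec" where
  "Phi d F lam = (\<lambda>(v, Dq).
     vec_rem (sys_eval F v) (monom 1 d + Dq) @\<^sub>v vec 1 (\<lambda>_. lincomb_poly lam v - var_T))"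

definition jac_Phi ::
  "'a::idom mpoly vec \<Rightarrow> 'a vec \<Rightarrow> 'a poly vec \<Rightarrow> 'a poly \<Rightarrow> 'a poly mat" where
  "jac_Phi F lam v q = mat_rem
     (four_block_mat
        (jac F v) (mat (dim_vec F) 1 (\<lambda>(i, _). - pquo (sys_eval F v $ i) q))
        (mat 1 (dim_vec F) (\<lambda>(_, j). [:lam $ j:])) (0\<^sub>m 1 1)) q"

definition w_vec :: "'a::idom mpoly vec \<Rightarrow> 'a poly vec \<Rightarrow> 'a poly \<Rightarrow> 'a poly vec" where
  "w_vec F v q = v - vec_rem (mat_inverse_mod q (jac F v) *\<^sub>v sys_eval F v) q"

definition Delta ::
  "'a::idom mpoly vec \<Rightarrow> 'a vec \<Rightarrow> 'a poly vec \<Rightarrow> 'a poly \<Rightarrow> 'a poly" where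
  "Delta F lam v q = lincomb_poly lam (w_vec F v q) - var_T"

definition r_vec :: "'a::idom mpoly vec \<Rightarrow> 'a poly vec \<Rightarrow> 'a poly \<Rightarrow> 'a poly vec" where
  "r_vec F v q = vec_rem (sys_eval F v) q"

definition U_vec :: "'a::idom mpoly vec \<Rightarrow> 'a poly vec \<Rightarrow> 'a poly \<Rightarrow> 'a poly vec" where
  "U_vec F v q = map_vec pderiv v
     - vec_rem (mat_inverse_mod q (jac F v) *\<^sub>v map_vec pderiv (r_vec F v q)) q"

definition Lambda ::
  "'a::idom mpoly vec \<Rightarrow> 'a vec \<Rightarrow> 'a poly vec \<Rightarrow> 'a poly \<Rightarrow> 'a poly" where
  "Lambda F lam v q = lincomb_poly lam (U_vec F v q)"

definition V_bar ::
  "'a::idom mpoly vec \<Rightarrow> 'a vec \<Rightarrow> 'a poly vec \<Rightarrow> 'a poly \<Rightarrow> 'a poly vec" where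
  "V_bar F lam v q = w_vec F v q
     - vec_rem (frac_mod q (Delta F lam v q) (Lambda F lam v q) \<cdot>\<^sub>v U_vec F v q) q"

definition Q_bar ::
  "'a::idom mpoly vec \<Rightarrow> 'a vec \<Rightarrow> 'a poly vec \<Rightarrow> 'a poly \<Rightarrow> 'a poly" where
  "Q_bar F lam v q =
     q - prem (frac_mod q (Delta F lam v q) (Lambda F lam v q) * pderiv q) q"


lemma pquo_prem:
  assumes "lead_coeff q = 1"
  shows "p = q * pquo p q + prem p q" and "prem p q = 0 \<or> degree (prem p q) < degree q"
proof -
  have q0: "q \<noteq> 0" using assms by auto
  have e: "pseudo_divmod p q = (pquo p q, prem p q)"
    by (simp add: pquo_def prem_def pseudo_mod_def)
  show "p = q * pquo p q + prem p q" using pseudo_divmod(1)[OF q0 e] assms by simp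
  show "prem p q = 0 \<or> degree (prem p q) < degree q" by (rule pseudo_divmod(2)[OF q0 e])
qed

lemma prem_unique:
  fixes q :: "'a::idom poly"
  assumes "lead_coeff q = 1" "p = q * s + r" "r = 0 \<or> degree r < degree q"
  shows "pquo p q = s" "prem p q = r"
proof -
  have q0: "q \<noteq> 0" using assms(1) by auto
  have e: "q * (pquo p q - s) = r - prem p q"
    using pquo_prem(1)[OF assms(1), of p] assms(2) by (simp add: algebra_simps)
  have d: "r - prem p q = 0 \<or> degree (r - prem p q) < degree q"
    using assms(3) pquo_prem(2)[OF assms(1), of p] degree_diff_less[of r "degree q" "prem p q"]
    by auto
  have "pquo p q - s = 0"
  proof (rule ccontr)
    assume n: "pquo p q - s \<noteq> 0"
    then have "degree (q * (pquo p q - s)) \<ge> degree q" using q0 by (simp add: degree_mult_eq)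
    moreover have "q * (pquo p q - s) \<noteq> 0" using n q0 by simp
    ultimately show False using d e by simp
  qed
  then show "pquo p q = s" "prem p q = r" using e by auto
qed

lemma prem_eq_iff:
  fixes q :: "'a::idom poly"
  assumes "lead_coeff q = 1"
  shows "prem a q = prem b q \<longleftrightarrow> q dvd a - b"
proof
  assume "prem a q = prem b q"
  then have "a - b = q * (pquo a q - pquo b q)"
    using pquo_prem(1)[OF assms, of a] pquo_prem(1)[OF assms, of b]
    by (metis (no_types, lifting) add_diff_cancel_right right_diff_distrib)
  then show "q dvd a - b" by simp
next
  assume "q dvd a - b"
  then obtain k where "a - b = q * k" by (elim dvdE)
  then have "a = q * (pquo b q + k) + prem b q"
    using pquo_prem(1)[OF assms, of b] by (simp add: algebra_simps)
  from prem_unique(2)[OF assms this] show "prem a q = prem b q"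
    using pquo_prem(2)[OF assms, of b] by blast
qed

end

theory Submission
  imports Defs
begin

text \<open>
  Write \<open>F(v) = q m + r\<close> and let \<open>J\<close> be the Jacobian of \<open>F\<close> at \<open>v\<close>.  Differentiating with the chain
  rule gives \<open>J v' \<equiv> q' m + r'\<close> modulo \<open>q\<close>, so that \<open>U \<equiv> q' J\<^sup>-\<^sup>1 m\<close> and
  \<open>\<Lambda> \<equiv> q' (\<lambda> \<bullet> J\<^sup>-\<^sup>1 m)\<close>.  The second factor is the Schur complement of \<open>J\<close> in the Jacobian of
  \<open>\<Phi>\<close>: if that Jacobian maps \<open>(x, t)\<close> to \<open>(0, 1)\<close>, then \<open>x \<equiv> t J\<^sup>-\<^sup>1 m\<close> and \<open>\<lambda> \<bullet> x \<equiv> 1\<close>, so it is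
  invertible.  With \<open>c = \<Delta> / \<Lambda>\<close>, the Jacobian of \<open>\<Phi>\<close> maps \<open>(J\<^sup>-\<^sup>1 F(v) + c U, c q')\<close> to
  \<open>(F(v), 0)\<close>, which identifies the two Newton steps.
\<close>

section \<open>Evaluation, formal partial derivatives and the chain rule\<close>

lemma mpoly_eval_superset:
  assumes "finite A" "Poly_Mapping.keys f \<subseteq> A"
  shows "mpoly_eval f v = (\<Sum>m\<in>A. smult (Poly_Mapping.lookup f m)
           (\<Prod>i\<in>Poly_Mapping.keys m. (v $ i) ^ Poly_Mapping.lookup m i))"
  unfolding mpoly_eval_def
  using assms by (intro sum.mono_neutral_left) (auto simp: in_keys_iff)

lemma mpoly_eval_add: "mpoly_eval (f + g) v = mpoly_eval f v + mpoly_eval g v"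
proof -
  \<comment> \<open>Terms of \<open>f\<close> and \<open>g\<close> may cancel in the sum, so all
    three supports are placed in one index set.\<close>
  let ?A = "Poly_Mapping.keys f \<union> Poly_Mapping.keys g"
  have "Poly_Mapping.keys (f + g) \<subseteq> ?A"
    by (rule Poly_Mapping.keys_add)
  then show ?thesis
    by (simp add: mpoly_eval_superset[of ?A] lookup_add smult_add_left sum.distrib)
qed

lemma mpoly_eval_0: "mpoly_eval 0 v = 0"
  by (simp add: mpoly_eval_def)

lemma mpoly_eval_sum: "mpoly_eval (\<Sum>x\<in>A. f x) v = (\<Sum>x\<in>A. mpoly_eval (f x) v)"
  by (induction A rule: infinite_finite_induct) (simp_all add: mpoly_eval_0 mpoly_eval_add)

lemma mpoly_eval_single:
  "mpoly_eval (Poly_Mapping.single m c) v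
     = smult c (\<Prod>i\<in>Poly_Mapping.keys m. (v $ i) ^ Poly_Mapping.lookup m i)"
  by (simp add: mpoly_eval_superset[of "{m}"])

text \<open>Evaluation is additive, so each monomial of \<open>f\<close> gives one summand even
  where shifted monomials coincide. A monomial without x_j is left unshifted by the truncated
  subtraction, but its coefficient is zero.\<close>

lemma mpoly_eval_mpoly_pderiv:
  "mpoly_eval (mpoly_pderiv j f) v =
     (\<Sum>m\<in>Poly_Mapping.keys f. smult (of_nat (Poly_Mapping.lookup m j) * Poly_Mapping.lookup f m)
        ((v $ j) ^ (Poly_Mapping.lookup m j - 1)
          * (\<Prod>i\<in>Poly_Mapping.keys m - {j}. (v $ i) ^ Poly_Mapping.lookup m i)))"
  unfolding mpoly_pderiv_def mpoly_eval_sum mpoly_eval_single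
proof (intro sum.cong refl)
  fix m :: "nat \<Rightarrow>\<^sub>0 nat"
  let ?m' = "m - Poly_Mapping.single j 1"
  show "smult (of_nat (Poly_Mapping.lookup m j) * Poly_Mapping.lookup f m)
          (\<Prod>i\<in>Poly_Mapping.keys ?m'. (v $ i) ^ Poly_Mapping.lookup ?m' i) =
        smult (of_nat (Poly_Mapping.lookup m j) * Poly_Mapping.lookup f m)
          ((v $ j) ^ (Poly_Mapping.lookup m j - 1)
          * (\<Prod>i\<in>Poly_Mapping.keys m - {j}. (v $ i) ^ Poly_Mapping.lookup m i))"
  proof (cases "j \<in> Poly_Mapping.keys m")
    case True
    \<comment> \<open>If x_j has exponent 1 in \<open>m\<close>, then \<open>j\<close> is missing
      from the keys of \<open>?m'\<close>; its factor is a zeroth power, so the product may run over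
      the keys of \<open>m\<close>.\<close>
    have "Poly_Mapping.keys ?m' \<subseteq> Poly_Mapping.keys m"
      by (auto simp: in_keys_iff lookup_minus)
    then have "(\<Prod>i\<in>Poly_Mapping.keys ?m'. (v $ i) ^ Poly_Mapping.lookup ?m' i)
        = (\<Prod>i\<in>Poly_Mapping.keys m. (v $ i) ^ Poly_Mapping.lookup ?m' i)"
      by (intro prod.mono_neutral_left) (auto simp: in_keys_iff)
    also have "\<dots> = (v $ j) ^ Poly_Mapping.lookup ?m' j
        * (\<Prod>i\<in>Poly_Mapping.keys m - {j}. (v $ i) ^ Poly_Mapping.lookup ?m' i)"
      using True by (simp add: prod.remove)
    also have "(\<Prod>i\<in>Poly_Mapping.keys m - {j}. (v $ i) ^ Poly_Mapping.lookup ?m' i)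
        = (\<Prod>i\<in>Poly_Mapping.keys m - {j}. (v $ i) ^ Poly_Mapping.lookup m i)"
      by (intro prod.cong) (auto simp: lookup_minus lookup_single)
    finally show ?thesis
      by (simp add: lookup_minus)
  qed (simp add: in_keys_iff)
qed

text \<open>The chain rule: apply the product rule to each monomial, then exchange the two sums. The
  bound on \<open>mpoly_vars\<close> lets the inner sum run over all j < n; the indices added for a
  monomial carry the factor \<open>Poly_Mapping.lookup m j = 0\<close>.\<close>

lemma pderiv_mpoly_eval:
  fixes f :: "'a::idom mpoly"
  assumes "mpoly_vars f \<subseteq> {..<n}"
  shows "pderiv (mpoly_eval f v) = (\<Sum>j<n. mpoly_eval (mpoly_pderiv j f) v * pderiv (v $ j))"
proof -
  let ?L = Poly_Mapping.lookup and ?K = Poly_Mapping.keys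
  let ?t = "\<lambda>m j. smult (of_nat (?L m j) * ?L f m)
    ((v $ j) ^ (?L m j - 1) * (\<Prod>i\<in>?K m - {j}. (v $ i) ^ ?L m i)) * pderiv (v $ j)"
  have "pderiv (mpoly_eval f v) = (\<Sum>m\<in>?K f. smult (?L f m) (pderiv (\<Prod>i\<in>?K m. (v $ i) ^ ?L m i)))"
    by (simp add: mpoly_eval_def higher_pderiv_sum[of 1, simplified] pderiv_smult)
  also have "\<dots> = (\<Sum>m\<in>?K f. \<Sum>j\<in>?K m. ?t m j)"
  proof (rule sum.cong[OF refl])
    fix m assume "m \<in> ?K f"
    have "smult (?L f m) (pderiv (\<Prod>i\<in>?K m. (v $ i) ^ ?L m i))
        = [:?L f m:] * pderiv (\<Prod>i\<in>?K m. (v $ i) ^ ?L m i)"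
      by simp
    also have "\<dots> = (\<Sum>j\<in>?K m. ?t m j)"
      unfolding pderiv_prod sum_distrib_left
      by (rule sum.cong[OF refl]) (simp add: pderiv_power algebra_simps)
    finally show "smult (?L f m) (pderiv (\<Prod>i\<in>?K m. (v $ i) ^ ?L m i)) = (\<Sum>j\<in>?K m. ?t m j)" .
  qed
  also have "\<dots> = (\<Sum>m\<in>?K f. \<Sum>j<n. ?t m j)"
  proof (rule sum.cong[OF refl], rule sum.mono_neutral_left)
    fix m assume "m \<in> ?K f"
    then show "?K m \<subseteq> {..<n}"
      using assms by (auto simp: mpoly_vars_def)
  qed (simp_all add: in_keys_iff)
  also have "\<dots> = (\<Sum>j<n. mpoly_eval (mpoly_pderiv j f) v * pderiv (v $ j))"
    by (subst sum.swap) (simp add: mpoly_eval_mpoly_pderiv sum_distrib_right)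
  finally show ?thesis .
qed

section \<open>Linear combinations and entrywise remainders\<close>

lemma mult_mat_vec_smult:
  fixes A :: "'a::comm_semiring_0 mat"
  assumes "A \<in> carrier_mat nr nc" "x \<in> carrier_vec nc"
  shows "A *\<^sub>v (k \<cdot>\<^sub>v x) = k \<cdot>\<^sub>v (A *\<^sub>v x)"
  using assms by (intro eq_vecI) auto

lemma lincomb_poly_add:
  assumes "lam \<in> carrier_vec n" "x \<in> carrier_vec n" "y \<in> carrier_vec n"
  shows "lincomb_poly lam (x + y) = lincomb_poly lam x + lincomb_poly lam y"
  using assms by (simp add: lincomb_poly_def smult_add_right sum.distrib)

lemma lincomb_poly_minus:
  assumes "lam \<in> carrier_vec n" "x \<in> carrier_vec n" "y \<in> carrier_vec n"
  shows "lincomb_poly lam (x - y) = lincomb_poly lam x - lincomb_poly lam y"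
  using assms by (simp add: lincomb_poly_def smult_diff_right sum_subtractf)

lemma lincomb_poly_smult:
  assumes "lam \<in> carrier_vec n" "x \<in> carrier_vec n"
  shows "lincomb_poly lam (c \<cdot>\<^sub>v x) = c * lincomb_poly lam x"
  using assms by (simp add: lincomb_poly_def sum_distrib_left)

lemma degree_lincomb_poly_le:
  assumes "\<And>i. i < dim_vec lam \<Longrightarrow> degree (x $ i) \<le> k"
  shows "degree (lincomb_poly lam x) \<le> k"
  unfolding lincomb_poly_def
  using assms by (intro degree_sum_le) (auto intro: order.trans[OF degree_smult_le])

lemma vec_rem_carrier [simp]: "vec_rem x q \<in> carrier_vec n \<longleftrightarrow> x \<in> carrier_vec n"
  by (simp add: vec_rem_def)

lemma dim_vec_rem [simp]: "dim_vec (vec_rem x q) = dim_vec x"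
  by (simp add: vec_rem_def)

lemma vec_rem_index [simp]: "i < dim_vec x \<Longrightarrow> vec_rem x q $ i = prem (x $ i) q"
  by (simp add: vec_rem_def)

lemma mat_rem_carrier [simp]: "mat_rem A q \<in> carrier_mat nr nc \<longleftrightarrow> A \<in> carrier_mat nr nc"
  by (simp add: mat_rem_def)

lemma dim_mat_rem [simp]:
  "dim_row (mat_rem A q) = dim_row A" "dim_col (mat_rem A q) = dim_col A"
  by (simp_all add: mat_rem_def)

lemma mat_rem_index [simp]:
  "i < dim_row A \<Longrightarrow> j < dim_col A \<Longrightarrow> mat_rem A q $$ (i, j) = prem (A $$ (i, j)) q"
  by (simp add: mat_rem_def)

lemma vec_rem_append: "vec_rem (x @\<^sub>v y) q = vec_rem x q @\<^sub>v vec_rem y q"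
  by (intro eq_vecI) auto

lemma vec_rem_vec: "vec_rem (vec k f) q = vec k (\<lambda>i. prem (f i) q)"
  by (intro eq_vecI) auto

text \<open>Positive length is essential, as all vectors of length 0 are equal. \<open>Suc k\<close>
  matches the form that \<open>simp\<close> gives to length 1.\<close>

lemma vec_const_eq_iff: "vec (Suc k) (\<lambda>_. a) = vec (Suc k) (\<lambda>_. b) \<longleftrightarrow> a = b"
  by (metis index_vec zero_less_Suc)

section \<open>Arithmetic in R[T]/<q> by canonical remainders\<close>

locale monic_modulus =
  fixes q :: "'a::idom poly"
  assumes monic: "lead_coeff q = 1"
begin

lemma prem_prem [simp]: "prem (prem a q) q = prem a q"
  using prem_unique(2)[OF monic, of "prem a q" 0 "prem a q"] pquo_prem(2)[OF monic, of a] by simp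

lemma prem_0 [simp]: "prem 0 q = 0"
  using prem_unique(2)[OF monic, of 0 0 0] by simp

text \<open>A sum of two remainders still has degree below that of \<open>q\<close>, so addition,
  unlike multiplication, commutes with reduction without a further \<open>prem\<close>.\<close>

lemma prem_add: "prem (a + b) q = prem a q + prem b q"
proof (rule prem_unique(2)[OF monic])
  show "a + b = q * (pquo a q + pquo b q) + (prem a q + prem b q)"
    using pquo_prem(1)[OF monic, of a] pquo_prem(1)[OF monic, of b] by (simp add: algebra_simps)
  show "prem a q + prem b q = 0 \<or> degree (prem a q + prem b q) < degree q"
    using pquo_prem(2)[OF monic, of a] pquo_prem(2)[OF monic, of b]
      degree_add_less[of "prem a q" "degree q" "prem b q"] by auto
qed

lemma prem_diff: "prem (a - b) q = prem a q - prem b q"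
  using prem_add[of "a - b" b] by (simp add: eq_diff_eq)

lemma prem_sum: "prem (\<Sum>x\<in>A. f x) q = (\<Sum>x\<in>A. prem (f x) q)"
  by (induction A rule: infinite_finite_induct) (simp_all add: prem_add)

lemma prem_self_mult [simp]: "prem (q * a) q = 0" "prem (a * q) q = 0"
  using prem_unique(2)[OF monic, of _ a 0] by (simp_all add: mult.commute)

lemma prem_mult_prem [simp]:
  "prem (prem a q * b) q = prem (a * b) q" "prem (b * prem a q) q = prem (b * a) q"
proof -
  have "a * b = q * (pquo a q * b) + prem a q * b"
    using pquo_prem(1)[OF monic, of a] by (metis mult.assoc distrib_right)
  then have "prem (a * b) q = prem (prem a q * b) q"
    by (metis prem_add prem_self_mult(1) add_0)
  then show "prem (prem a q * b) q = prem (a * b) q" "prem (b * prem a q) q = prem (b * a) q"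
    by (simp_all add: mult.commute)
qed

lemma prem_mult_cong:
  assumes "prem a q = prem a' q" "prem b q = prem b' q"
  shows "prem (a * b) q = prem (a' * b') q"
  by (metis assms prem_mult_prem)

text \<open>Also true for \<open>degree q = 0\<close>, where the truncated bound is 0 and the
  remainder is zero. The form matches the degree bound on the v_i.\<close>

lemma degree_prem_le: "degree (prem a q) \<le> degree q - 1"
  using pquo_prem(2)[OF monic, of a] by auto

lemma prem_eq_self: "degree a < degree q \<Longrightarrow> prem a q = a"
  using prem_unique(2)[OF monic, of a 0 a] by simp

lemma prem_smult_prem [simp]: "prem (smult c (prem a q)) q = prem (smult c a) q"
  using prem_mult_prem(2)[of "[:c:]" a] by simp

lemma vec_rem_add:
  "dim_vec x = dim_vec y \<Longrightarrow> vec_rem (x + y) q = vec_rem x q + vec_rem y q"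
  by (intro eq_vecI) (auto simp: prem_add)

lemma vec_rem_minus:
  "dim_vec x = dim_vec y \<Longrightarrow> vec_rem (x - y) q = vec_rem x q - vec_rem y q"
  by (intro eq_vecI) (auto simp: prem_diff)

lemma vec_rem_vec_rem [simp]: "vec_rem (vec_rem x q) q = vec_rem x q"
  by (intro eq_vecI) auto

lemma vec_rem_smult_cong:
  assumes "prem a q = prem b q" "vec_rem x q = vec_rem y q"
  shows "vec_rem (a \<cdot>\<^sub>v x) q = vec_rem (b \<cdot>\<^sub>v y) q"
proof -
  have d: "dim_vec x = dim_vec y"
    using arg_cong[OF assms(2), of dim_vec] by simp
  have "prem (x $ i) q = prem (y $ i) q" if "i < dim_vec y" for i
    using arg_cong[OF assms(2), of "\<lambda>z. z $ i"] that d by simp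
  then show ?thesis
    using d assms(1) by (intro eq_vecI) (auto intro: prem_mult_cong)
qed

lemma prem_lincomb_poly_cong:
  assumes "lam \<in> carrier_vec n" "x \<in> carrier_vec n" "vec_rem x q = vec_rem y q"
  shows "prem (lincomb_poly lam x) q = prem (lincomb_poly lam y) q"
proof -
  have d: "dim_vec x = n" "dim_vec y = n"
    using assms(2) arg_cong[OF assms(3), of dim_vec] by auto
  have "prem (x $ i) q = prem (y $ i) q" if "i < n" for i
    using arg_cong[OF assms(3), of "\<lambda>z. z $ i"] that d by simp
  then have "prem (smult (lam $ i) (x $ i)) q = prem (smult (lam $ i) (y $ i)) q" if "i < n" for i
    using that by (metis prem_smult_prem)
  then show ?thesis
    using assms(1) by (simp add: lincomb_poly_def prem_sum)
qed

lemma prem_scalar_prod_cong: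
  assumes "dim_vec x = dim_vec x'" "dim_vec y = dim_vec y'"
    and "\<And>i. i < dim_vec y \<Longrightarrow> prem (x $ i) q = prem (x' $ i) q"
    and "\<And>i. i < dim_vec y \<Longrightarrow> prem (y $ i) q = prem (y' $ i) q"
  shows "prem (x \<bullet> y) q = prem (x' \<bullet> y') q"
  using assms by (auto simp: scalar_prod_def prem_sum intro!: sum.cong prem_mult_cong)

lemma vec_rem_mat_rem_mult [simp]:
  assumes "A \<in> carrier_mat nr nc" "x \<in> carrier_vec nc"
  shows "vec_rem (mat_rem A q *\<^sub>v x) q = vec_rem (A *\<^sub>v x) q"
  using assms by (intro eq_vecI) (auto intro!: prem_scalar_prod_cong)

lemma vec_rem_mult_vec_rem [simp]:
  assumes "A \<in> carrier_mat nr nc" "x \<in> carrier_vec nc"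
  shows "vec_rem (A *\<^sub>v vec_rem x q) q = vec_rem (A *\<^sub>v x) q"
  using assms by (intro eq_vecI) (auto intro!: prem_scalar_prod_cong)

section \<open>Inverse matrices and fractions modulo q\<close>

lemma mat_rem_mat_rem [simp]: "mat_rem (mat_rem A q) q = mat_rem A q"
  by (intro eq_matI) auto

lemma mat_rem_mult_mat_rem:
  assumes "A \<in> carrier_mat nr n" "B \<in> carrier_mat n nc"
  shows "mat_rem (mat_rem A q * B) q = mat_rem (A * B) q"
    and "mat_rem (A * mat_rem B q) q = mat_rem (A * B) q"
  using assms by (auto intro!: eq_matI prem_scalar_prod_cong)

text \<open>The classical B = B(AC) = (BA)C = C, carried out modulo \<open>q\<close>.\<close>

lemma is_mat_inverse_mod_unique:
  assumes "is_mat_inverse_mod q A B" "is_mat_inverse_mod q A C"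
  shows "mat_rem B q = mat_rem C q"
proof -
  define n where "n = dim_row A"
  have A: "A \<in> carrier_mat n n" and B: "B \<in> carrier_mat n n" and C: "C \<in> carrier_mat n n"
    using assms unfolding is_mat_inverse_mod_def n_def by auto
  have AC: "mat_rem (A * C) q = mat_rem (1\<^sub>m n) q" and BA: "mat_rem (B * A) q = mat_rem (1\<^sub>m n) q"
    using assms unfolding is_mat_inverse_mod_def n_def by auto
  have "mat_rem B q = mat_rem (B * mat_rem (1\<^sub>m n) q) q"
    using B by (simp add: mat_rem_mult_mat_rem(2)[of B n n _ n])
  also have "\<dots> = mat_rem (B * (A * C)) q"
    using A B C by (simp add: AC[symmetric] mat_rem_mult_mat_rem(2)[of B n n _ n])
  also have "\<dots> = mat_rem (mat_rem (B * A) q * C) q"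
    using A B C by (simp add: mat_rem_mult_mat_rem(1)[of _ n n _ n] assoc_mult_mat[of B n n A n C n])
  also have "\<dots> = mat_rem C q"
    using C by (simp add: BA mat_rem_mult_mat_rem(1)[of _ n n _ n])
  finally show ?thesis .
qed

text \<open>Justifies the definite description: reducing any inverse entrywise gives a canonical
  one, and uniqueness modulo \<open>q\<close> determines it.\<close>

lemma is_mat_inverse_mod_mat_inverse_mod:
  assumes "invertible_mat_mod q A"
  shows "is_mat_inverse_mod q A (mat_inverse_mod q A)"
proof -
  obtain B where B: "is_mat_inverse_mod q A B"
    using assms by (auto simp: invertible_mat_mod_def)
  have "is_mat_inverse_mod q A (mat_rem B q)"
    using B unfolding is_mat_inverse_mod_def
    by (simp add: mat_rem_mult_mat_rem[of _ "dim_row A" "dim_row A" _ "dim_row A"])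
  then have "\<exists>!C. mat_rem C q = C \<and> is_mat_inverse_mod q A C"
    using is_mat_inverse_mod_unique by (metis mat_rem_mat_rem)
  from theI'[OF this] show ?thesis
    by (simp add: mat_inverse_mod_def)
qed

lemma mat_inverse_mod_carrier:
  assumes "invertible_mat_mod q A" "A \<in> carrier_mat n n"
  shows "mat_inverse_mod q A \<in> carrier_mat n n"
  using is_mat_inverse_mod_mat_inverse_mod[OF assms(1)] assms(2)
  by (simp add: is_mat_inverse_mod_def)

lemma mult_mat_inverse_mod_vec:
  assumes "invertible_mat_mod q A" "A \<in> carrier_mat n n" "x \<in> carrier_vec n"
  shows "vec_rem (A *\<^sub>v (mat_inverse_mod q A *\<^sub>v x)) q = vec_rem x q"
    and "vec_rem (mat_inverse_mod q A *\<^sub>v (A *\<^sub>v x)) q = vec_rem x q"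
proof -
  let ?B = "mat_inverse_mod q A"
  note B = mat_inverse_mod_carrier[OF assms(1,2)]
  have inv: "mat_rem (A * ?B) q = mat_rem (1\<^sub>m n) q" "mat_rem (?B * A) q = mat_rem (1\<^sub>m n) q"
    using is_mat_inverse_mod_mat_inverse_mod[OF assms(1)] assms(2)
    by (auto simp: is_mat_inverse_mod_def)
  have one: "vec_rem (mat_rem (1\<^sub>m n) q *\<^sub>v x) q = vec_rem x q"
    using assms(3) by (simp add: vec_rem_mat_rem_mult[of _ n n])
  have "vec_rem (mat_rem (A * ?B) q *\<^sub>v x) q = vec_rem (A *\<^sub>v (?B *\<^sub>v x)) q"
    using assms B by (simp add: vec_rem_mat_rem_mult[of _ n n])
  then show "vec_rem (A *\<^sub>v (?B *\<^sub>v x)) q = vec_rem x q"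
    by (simp add: inv one)
  have "vec_rem (mat_rem (?B * A) q *\<^sub>v x) q = vec_rem (?B *\<^sub>v (A *\<^sub>v x)) q"
    using assms B by (simp add: vec_rem_mat_rem_mult[of _ n n])
  then show "vec_rem (?B *\<^sub>v (A *\<^sub>v x)) q = vec_rem x q"
    by (simp add: inv one)
qed

text \<open>To know the inverse of \<open>A\<close> applied to \<open>b\<close> it suffices to
  exhibit a solution of A x = b modulo \<open>q\<close>. In this way the inverse of the Jacobian of
  Phi never has to be written out.\<close>

lemma mat_inverse_mod_mult_vec_eqI:
  assumes "invertible_mat_mod q A" "A \<in> carrier_mat n n" "x \<in> carrier_vec n" "b \<in> carrier_vec n"
    and "vec_rem (A *\<^sub>v x) q = vec_rem b q"
  shows "vec_rem (mat_inverse_mod q A *\<^sub>v b) q = vec_rem x q"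
proof -
  note B = mat_inverse_mod_carrier[OF assms(1,2)]
  have "vec_rem (mat_inverse_mod q A *\<^sub>v b) q
      = vec_rem (mat_inverse_mod q A *\<^sub>v vec_rem b q) q"
    using B assms(4) by (simp add: vec_rem_mult_vec_rem[of _ n n])
  also have "\<dots> = vec_rem (mat_inverse_mod q A *\<^sub>v (A *\<^sub>v x)) q"
    using B assms(2,3) by (simp add: vec_rem_mult_vec_rem[of _ n n] flip: assms(5))
  also have "\<dots> = vec_rem x q"
    by (rule mult_mat_inverse_mod_vec(2)[OF assms(1-3)])
  finally show ?thesis .
qed

text \<open>If \<open>s\<close> inverts \<open>b\<close>, then a s is a fraction, and any fraction
  \<open>c\<close> satisfies c = c b s = a s modulo \<open>q\<close>. This makes the description in
  \<open>frac_mod\<close> meaningful.\<close>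

lemma frac_mod_unique_exists:
  assumes "invertible_mod q b"
  shows "\<exists>!c. prem c q = c \<and> prem (c * b) q = prem a q"
proof -
  obtain s where s: "prem (b * s) q = prem 1 q"
    using assms by (auto simp: invertible_mod_def)
  have cancel: "prem (c * (b * s)) q = prem c q" for c
    using prem_mult_cong[OF refl s, of c] by simp
  show ?thesis
  proof (rule ex1I[of _ "prem (a * s) q"])
    show "prem (prem (a * s) q) q = prem (a * s) q \<and> prem (prem (a * s) q * b) q = prem a q"
      using cancel[of a] by (simp add: mult_ac)
    fix c assume c: "prem c q = c \<and> prem (c * b) q = prem a q"
    have "c = prem ((c * b) * s) q"
      using cancel[of c] c by (simp add: mult_ac)
    also have "\<dots> = prem (a * s) q"
      using c by (intro prem_mult_cong) auto
    finally show "c = prem (a * s) q" .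
  qed
qed

lemma prem_frac_mod_mult:
  assumes "invertible_mod q b"
  shows "prem (frac_mod q a b * b) q = prem a q"
  using theI'[OF frac_mod_unique_exists[OF assms, of a]] by (simp add: frac_mod_def)

lemma invertible_mod_mult:
  assumes "invertible_mod q a" "invertible_mod q b"
  shows "invertible_mod q (a * b)"
proof -
  obtain s t where "prem (a * s) q = prem 1 q" "prem (b * t) q = prem 1 q"
    using assms by (auto simp: invertible_mod_def)
  from prem_mult_cong[OF this] have "prem ((a * b) * (s * t)) q = prem 1 q"
    by (simp add: mult_ac)
  then show ?thesis
    unfolding invertible_mod_def by blast
qed

lemma invertible_mod_cong:
  assumes "prem a q = prem b q"
  shows "invertible_mod q a \<longleftrightarrow> invertible_mod q b"
  using prem_mult_cong[OF assms refl] by (simp add: invertible_mod_def)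

end

section \<open>The quotient vector m = (m_1, ..., m_n) and the Jacobians of F and Phi\<close>

definition pquo_vec :: "'a::idom mpoly vec \<Rightarrow> 'a poly vec \<Rightarrow> 'a poly \<Rightarrow> 'a poly vec" where
  "pquo_vec F v q = map_vec (\<lambda>p. pquo p q) (sys_eval F v)"

lemma sys_eval_carrier [simp]: "sys_eval F v \<in> carrier_vec n \<longleftrightarrow> F \<in> carrier_vec n"
  by (simp add: sys_eval_def)

lemma pquo_vec_carrier [simp]: "pquo_vec F v q \<in> carrier_vec n \<longleftrightarrow> F \<in> carrier_vec n"
  by (simp add: pquo_vec_def)

lemma r_vec_carrier [simp]: "r_vec F v q \<in> carrier_vec n \<longleftrightarrow> F \<in> carrier_vec n"
  by (simp add: r_vec_def)

lemma jac_carrier: "F \<in> carrier_vec n \<Longrightarrow> jac F v \<in> carrier_mat n n"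
  by (simp add: jac_def)

lemma jac_Phi_carrier: "F \<in> carrier_vec n \<Longrightarrow> jac_Phi F lam v q \<in> carrier_mat (n + 1) (n + 1)"
  by (intro carrier_matI) (simp_all add: jac_Phi_def jac_def)

text \<open>The chain rule in matrix form, an exact identity before any reduction modulo q.\<close>

lemma jac_mult_pderiv:
  fixes F :: "'a::idom mpoly vec"
  assumes F: "F \<in> carrier_vec n" "\<forall>i<n. mpoly_vars (F $ i) \<subseteq> {..<n}" and v: "v \<in> carrier_vec n"
  shows "jac F v *\<^sub>v map_vec pderiv v = map_vec pderiv (sys_eval F v)"
proof (rule eq_vecI)
  fix i assume "i < dim_vec (map_vec pderiv (sys_eval F v))"
  then have i: "i < n"
    using F by (simp add: sys_eval_def)
  then show "(jac F v *\<^sub>v map_vec pderiv v) $ i = map_vec pderiv (sys_eval F v) $ i"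
    using F v pderiv_mpoly_eval[of "F $ i" n v]
    by (simp add: sys_eval_def jac_def scalar_prod_def lessThan_atLeast0)
qed (use F in \<open>simp add: jac_def sys_eval_def\<close>)

context monic_modulus
begin

lemma sys_eval_eq_pquo_prem:
  "sys_eval F v = q \<cdot>\<^sub>v pquo_vec F v q + r_vec F v q"
  by (intro eq_vecI) (auto simp: pquo_vec_def r_vec_def vec_rem_def pquo_prem(1)[OF monic])

text \<open>Differentiation does not commute with reduction modulo \<open>q\<close>: differentiating
  F(v) = q m + r leaves q' m besides r', while q m' disappears.\<close>

lemma vec_rem_pderiv_sys_eval:
  "vec_rem (map_vec pderiv (sys_eval F v)) q
     = vec_rem (pderiv q \<cdot>\<^sub>v pquo_vec F v q + map_vec pderiv (r_vec F v q)) q"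
  (is "?l = ?r")
proof (rule eq_vecI)
  fix i assume "i < dim_vec ?r"
  then have i: "i < dim_vec F"
    by (simp add: r_vec_def sys_eval_def)
  have "sys_eval F v $ i = q * pquo_vec F v q $ i + r_vec F v q $ i"
    using i by (subst sys_eval_eq_pquo_prem) (simp add: pquo_vec_def r_vec_def sys_eval_def)
  then have "pderiv (sys_eval F v $ i) = q * pderiv (pquo_vec F v q $ i)
      + (pderiv q * pquo_vec F v q $ i + pderiv (r_vec F v q $ i))"
    by (simp add: pderiv_add pderiv_mult)
  then show "?l $ i = ?r $ i"
    using i by (simp add: prem_add pquo_vec_def r_vec_def sys_eval_def)
qed (simp add: r_vec_def)

text \<open>Block multiplication with last column -m and last row lambda; the outer remainder
  absorbs the one built into \<open>jac_Phi\<close>.\<close>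

lemma vec_rem_jac_Phi_mult:
  assumes F: "F \<in> carrier_vec n" and lam: "lam \<in> carrier_vec n" and x: "x \<in> carrier_vec n"
  shows "vec_rem (jac_Phi F lam v q *\<^sub>v (x @\<^sub>v vec 1 (\<lambda>_. t))) q
     = vec_rem (jac F v *\<^sub>v x - t \<cdot>\<^sub>v pquo_vec F v q) q @\<^sub>v vec 1 (\<lambda>_. prem (lincomb_poly lam x) q)"
proof -
  let ?B = "mat (dim_vec F) 1 (\<lambda>(i, _). - pquo (sys_eval F v $ i) q)"
  let ?C = "mat 1 (dim_vec F) (\<lambda>(_, j). [:lam $ j:])"
  let ?t = "vec 1 (\<lambda>_. t)"
  let ?M = "four_block_mat (jac F v) ?B ?C (0\<^sub>m 1 1)"
  have M: "?M \<in> carrier_mat (n + 1) (n + 1)"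
    using F by (intro carrier_matI) (simp_all add: jac_def)
  have z: "x @\<^sub>v ?t \<in> carrier_vec (n + 1)"
    using x by (intro carrier_vecI) simp
  have top: "jac F v *\<^sub>v x + ?B *\<^sub>v ?t = jac F v *\<^sub>v x - t \<cdot>\<^sub>v pquo_vec F v q"
    using F by (intro eq_vecI) (auto simp: jac_def pquo_vec_def sys_eval_def scalar_prod_def)
  have bot: "?C *\<^sub>v x + 0\<^sub>m 1 1 *\<^sub>v ?t = vec 1 (\<lambda>_. lincomb_poly lam x)"
    using F lam x
    by (intro eq_vecI) (auto simp: lincomb_poly_def scalar_prod_def lessThan_atLeast0)
  have "?M *\<^sub>v (x @\<^sub>v ?t) = (jac F v *\<^sub>v x + ?B *\<^sub>v ?t) @\<^sub>v (?C *\<^sub>v x + 0\<^sub>m 1 1 *\<^sub>v ?t)"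
    using F x by (intro four_block_mat_mult_vec) (auto simp: jac_def)
  then show ?thesis
    unfolding jac_Phi_def vec_rem_mat_rem_mult[OF M z] top bot
    by (simp add: vec_rem_append vec_rem_vec)
qed

section \<open>Invertibility of Lambda and the Newton step for Phi\<close>

context
  fixes F :: "'a mpoly vec" and lam :: "'a vec" and v :: "'a poly vec" and n :: nat
  assumes F: "F \<in> carrier_vec n" "\<forall>i<n. mpoly_vars (F $ i) \<subseteq> {..<n}"
    and lam: "lam \<in> carrier_vec n"
    and v: "v \<in> carrier_vec n"
    and jac: "invertible_mat_mod q (jac F v)"
begin

lemma mat_inverse_mod_jac_carrier: "mat_inverse_mod q (jac F v) \<in> carrier_mat n n"
  using mat_inverse_mod_carrier[OF jac jac_carrier[OF F(1)]] .

lemma U_vec_carrier: "U_vec F v q \<in> carrier_vec n"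
  using mat_inverse_mod_jac_carrier F v unfolding U_vec_def
  by (intro minus_carrier_vec) auto

lemma w_vec_carrier: "w_vec F v q \<in> carrier_vec n"
  using mat_inverse_mod_jac_carrier F v unfolding w_vec_def
  by (intro minus_carrier_vec) auto

text \<open>By the chain rule J v' is q' m + r' modulo \<open>q\<close>, and subtracting J J^-1 r'
  removes r'.\<close>

lemma vec_rem_jac_mult_U_vec:
  "vec_rem (jac F v *\<^sub>v U_vec F v q) q = vec_rem (pderiv q \<cdot>\<^sub>v pquo_vec F v q) q"
proof -
  let ?J = "jac F v" and ?Ji = "mat_inverse_mod q (jac F v)" and ?r' = "map_vec pderiv (r_vec F v q)"
  note J = jac_carrier[OF F(1), of v] and Ji = mat_inverse_mod_jac_carrier
  have r: "?r' \<in> carrier_vec n" and m: "pquo_vec F v q \<in> carrier_vec n"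
    using F by auto
  have Jir: "?Ji *\<^sub>v ?r' \<in> carrier_vec n"
    using Ji r by simp
  have "vec_rem (?J *\<^sub>v U_vec F v q) q
      = vec_rem (?J *\<^sub>v map_vec pderiv v) q - vec_rem (?J *\<^sub>v vec_rem (?Ji *\<^sub>v ?r') q) q"
    unfolding U_vec_def using J v Jir
    by (subst mult_minus_distrib_mat_vec[of _ n n]) (simp_all add: vec_rem_minus)
  also have "vec_rem (?J *\<^sub>v vec_rem (?Ji *\<^sub>v ?r') q) q = vec_rem ?r' q"
    using vec_rem_mult_vec_rem[OF J Jir] mult_mat_inverse_mod_vec(1)[OF jac J r] by simp
  also have "vec_rem (?J *\<^sub>v map_vec pderiv v) q
      = vec_rem (pderiv q \<cdot>\<^sub>v pquo_vec F v q) q + vec_rem ?r' q"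
    using m r by (simp add: jac_mult_pderiv[OF F v] vec_rem_pderiv_sys_eval vec_rem_add)
  also have "vec_rem (pderiv q \<cdot>\<^sub>v pquo_vec F v q) q + vec_rem ?r' q - vec_rem ?r' q
      = vec_rem (pderiv q \<cdot>\<^sub>v pquo_vec F v q) q"
    using m r by (intro eq_vecI) auto
  finally show ?thesis .
qed

text \<open>Multiplying by J^-1 gives x = t J^-1 m modulo \<open>q\<close>. Used with x = U and t =
  q', and with the solution (x, t) of J_Phi (x, t) = (0, 1); this links Lambda to the invertibility
  of J_Phi.\<close>

lemma prem_lincomb_poly_if_jac_mult:
  assumes "x \<in> carrier_vec n" "vec_rem (jac F v *\<^sub>v x) q = vec_rem (t \<cdot>\<^sub>v pquo_vec F v q) q"
  shows "prem (lincomb_poly lam x) q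
    = prem (t * lincomb_poly lam (mat_inverse_mod q (jac F v) *\<^sub>v pquo_vec F v q)) q"
proof -
  let ?Ji = "mat_inverse_mod q (jac F v)"
  note Ji = mat_inverse_mod_jac_carrier
  have m: "pquo_vec F v q \<in> carrier_vec n"
    using F by simp
  have "vec_rem x q = vec_rem (?Ji *\<^sub>v (t \<cdot>\<^sub>v pquo_vec F v q)) q"
    using mat_inverse_mod_mult_vec_eqI[OF jac jac_carrier[OF F(1)] assms(1) _ assms(2)] m by simp
  also have "?Ji *\<^sub>v (t \<cdot>\<^sub>v pquo_vec F v q) = t \<cdot>\<^sub>v (?Ji *\<^sub>v pquo_vec F v q)"
    by (rule mult_mat_vec_smult[OF Ji m])
  finally show ?thesis
    using prem_lincomb_poly_cong[OF lam assms(1)] lincomb_poly_smult[OF lam mult_mat_vec_carrier[OF Ji m]]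
    by metis
qed

text \<open>No determinant is involved: the last coordinate of J_Phi^-1 (0, 1) is itself an inverse
  of the Schur complement.\<close>

lemma invertible_mod_lincomb_if_jac_Phi:
  assumes "invertible_mat_mod q (jac_Phi F lam v q)"
  shows "invertible_mod q (lincomb_poly lam (mat_inverse_mod q (jac F v) *\<^sub>v pquo_vec F v q))"
proof -
  let ?b = "0\<^sub>v n @\<^sub>v vec 1 (\<lambda>_. 1)" and ?P = "jac_Phi F lam v q"
  note P = jac_Phi_carrier[OF F(1), of lam v q] and J = jac_carrier[OF F(1), of v]
  define z where "z = mat_inverse_mod q ?P *\<^sub>v ?b"
  define x where "x = vec n (\<lambda>i. z $ i)"
  have b: "?b \<in> carrier_vec (n + 1)"
    by (rule carrier_vecI) simp
  have "z \<in> carrier_vec (n + 1)"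
    unfolding z_def by (rule mult_mat_vec_carrier[OF mat_inverse_mod_carrier[OF assms P] b])
  then have z: "z = x @\<^sub>v vec 1 (\<lambda>_. z $ n)"
    by (intro eq_vecI) (auto simp: x_def less_Suc_eq)
  have x: "x \<in> carrier_vec n"
    by (simp add: x_def)
  have m: "pquo_vec F v q \<in> carrier_vec n"
    using F by simp
  have "vec_rem (?P *\<^sub>v z) q = vec_rem ?b q"
    unfolding z_def by (rule mult_mat_inverse_mod_vec(1)[OF assms P b])
  then have "vec_rem (?P *\<^sub>v (x @\<^sub>v vec 1 (\<lambda>_. z $ n))) q = vec_rem ?b q"
    using z by metis
  then have "vec_rem (jac F v *\<^sub>v x - z $ n \<cdot>\<^sub>v pquo_vec F v q) q
      @\<^sub>v vec 1 (\<lambda>_. prem (lincomb_poly lam x) q)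
      = vec_rem (0\<^sub>v n) q @\<^sub>v vec 1 (\<lambda>_. prem 1 q)"
    unfolding vec_rem_jac_Phi_mult[OF F(1) lam x] vec_rem_append vec_rem_vec .
  moreover have "vec_rem (jac F v *\<^sub>v x - z $ n \<cdot>\<^sub>v pquo_vec F v q) q \<in> carrier_vec n"
    using m by (intro carrier_vecI) simp
  ultimately have eq: "vec_rem (jac F v *\<^sub>v x - z $ n \<cdot>\<^sub>v pquo_vec F v q) q = vec_rem (0\<^sub>v n) q"
      "prem (lincomb_poly lam x) q = prem 1 q"
    using append_vec_eq[of _ n "vec_rem (0\<^sub>v n) q"] by (simp_all add: vec_const_eq_iff)
  \<comment> \<open>The upper block says that J x - t m vanishes modulo \<open>q\<close>, where t is
    \<open>z $ n\<close>; adding t m back gives J x = t m modulo \<open>q\<close>.\<close>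
  have "vec_rem (jac F v *\<^sub>v x) q
      = vec_rem ((jac F v *\<^sub>v x - z $ n \<cdot>\<^sub>v pquo_vec F v q) + z $ n \<cdot>\<^sub>v pquo_vec F v q) q"
    using J x m by (intro arg_cong[of _ _ "\<lambda>y. vec_rem y q"] eq_vecI) auto
  also have "\<dots> = vec_rem (z $ n \<cdot>\<^sub>v pquo_vec F v q) q"
    using J x m by (subst vec_rem_add) (auto simp: eq(1) intro!: eq_vecI)
  finally have "prem (lincomb_poly lam x) q = prem (z $ n
      * lincomb_poly lam (mat_inverse_mod q (jac F v) *\<^sub>v pquo_vec F v q)) q"
    by (rule prem_lincomb_poly_if_jac_mult[OF x])
  with eq(2) show ?thesis
    unfolding invertible_mod_def by (metis mult.commute)
qed

text \<open>Modulo \<open>q\<close>, Lambda is the product of q' and the Schur complement, and both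
  factors are units.\<close>

lemma invertible_mod_Lambda:
  assumes "invertible_mod q (pderiv q)" "invertible_mat_mod q (jac_Phi F lam v q)"
  shows "invertible_mod q (Lambda F lam v q)"
proof -
  note eq = prem_lincomb_poly_if_jac_mult[OF U_vec_carrier vec_rem_jac_mult_U_vec]
  show ?thesis
    unfolding Lambda_def invertible_mod_cong[OF eq]
    by (intro invertible_mod_mult invertible_mod_lincomb_if_jac_Phi assms)
qed

text \<open>The claimed value is verified as a solution of J_Phi (a, b) = (F(v), 0) modulo
  \<open>q\<close>. The upper block holds because J U = q' m, the last entry because c Lambda =
  Delta.\<close>

lemma vec_rem_newton_step:
  fixes c :: "'a poly"
  assumes T: "lincomb_poly lam v = var_T"
    and Phi: "invertible_mat_mod q (jac_Phi F lam v q)"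
    and c: "prem (c * Lambda F lam v q) q = prem (Delta F lam v q) q"
  shows "vec_rem (mat_inverse_mod q (jac_Phi F lam v q) *\<^sub>v (sys_eval F v @\<^sub>v vec 1 (\<lambda>_. 0))) q
    = (vec_rem (mat_inverse_mod q (jac F v) *\<^sub>v sys_eval F v) q + vec_rem (c \<cdot>\<^sub>v U_vec F v q) q)
        @\<^sub>v vec 1 (\<lambda>_. prem (c * pderiv q) q)"
proof -
  let ?Ji = "mat_inverse_mod q (jac F v)" and ?J = "jac F v" and ?F = "sys_eval F v"
  let ?U = "U_vec F v q" and ?m = "pquo_vec F v q"
  \<comment> \<open>The pair (a, b) is the total correction to v and q, up to reduction; the
    remainders are restored at the end.\<close>
  define a where "a = ?Ji *\<^sub>v ?F + c \<cdot>\<^sub>v ?U"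
  define b where "b = c * pderiv q"
  note P = jac_Phi_carrier[OF F(1), of lam v q] and J = jac_carrier[OF F(1), of v]
    and Ji = mat_inverse_mod_jac_carrier and U = U_vec_carrier
  have Fv: "?F \<in> carrier_vec n" and m: "?m \<in> carrier_vec n"
    using F by simp_all
  have JiF: "?Ji *\<^sub>v ?F \<in> carrier_vec n" and JU: "?J *\<^sub>v ?U \<in> carrier_vec n"
    using Ji J U Fv by simp_all
  have a: "a \<in> carrier_vec n"
    using JiF U by (simp add: a_def)
  have Ja: "?J *\<^sub>v a = ?J *\<^sub>v (?Ji *\<^sub>v ?F) + c \<cdot>\<^sub>v (?J *\<^sub>v ?U)"
    using J JiF U by (simp add: a_def mult_add_distrib_mat_vec[OF J] mult_mat_vec_smult[OF J])
  \<comment> \<open>The contribution of c U to the upper block is c q' m = b m, exactly what the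
    column -m with weight \<open>b\<close> cancels.\<close>
  have "vec_rem (c \<cdot>\<^sub>v (?J *\<^sub>v ?U)) q = vec_rem (c \<cdot>\<^sub>v (pderiv q \<cdot>\<^sub>v ?m)) q"
    by (rule vec_rem_smult_cong[OF refl vec_rem_jac_mult_U_vec])
  also have "\<dots> = vec_rem (b \<cdot>\<^sub>v ?m) q"
    by (simp add: b_def smult_smult_assoc)
  finally have cJU: "vec_rem (c \<cdot>\<^sub>v (?J *\<^sub>v ?U)) q = vec_rem (b \<cdot>\<^sub>v ?m) q" .
  have "vec_rem (?J *\<^sub>v a - b \<cdot>\<^sub>v ?m) q
      = vec_rem (?J *\<^sub>v (?Ji *\<^sub>v ?F)) q + vec_rem (b \<cdot>\<^sub>v ?m) q - vec_rem (b \<cdot>\<^sub>v ?m) q"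
    using J JiF JU m by (simp add: Ja vec_rem_minus vec_rem_add cJU)
  also have "\<dots> = vec_rem ?F q"
    using m Fv by (intro eq_vecI) (auto simp: mult_mat_inverse_mod_vec(1)[OF jac J Fv])
  finally have top: "vec_rem (?J *\<^sub>v a - b \<cdot>\<^sub>v ?m) q = vec_rem ?F q" .
  \<comment> \<open>As lambda . v = T, only the correction term of w survives in Delta, with a minus
    sign; it will cancel against c Lambda.\<close>
  have "Delta F lam v q = - lincomb_poly lam (vec_rem (?Ji *\<^sub>v ?F) q)"
    using JiF T by (simp add: Delta_def w_vec_def lincomb_poly_minus[OF lam v])
  then have "prem (lincomb_poly lam (?Ji *\<^sub>v ?F)) q = prem (- Delta F lam v q) q"
    using prem_lincomb_poly_cong[OF lam JiF, of "vec_rem (?Ji *\<^sub>v ?F) q"] by simp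
  then have bot: "prem (lincomb_poly lam a) q = prem 0 q"
    using c prem_diff[of 0 "Delta F lam v q"] lincomb_poly_add[OF lam JiF, of "c \<cdot>\<^sub>v ?U"] U
    by (simp add: a_def prem_add lincomb_poly_smult[OF lam U] Lambda_def)
  have F0: "?F @\<^sub>v vec 1 (\<lambda>_. 0) \<in> carrier_vec (n + 1)"
    and ab: "a @\<^sub>v vec 1 (\<lambda>_. b) \<in> carrier_vec (n + 1)"
    using Fv a by (auto intro!: carrier_vecI)
  have "vec_rem (mat_inverse_mod q (jac_Phi F lam v q) *\<^sub>v (?F @\<^sub>v vec 1 (\<lambda>_. 0))) q
      = vec_rem (a @\<^sub>v vec 1 (\<lambda>_. b)) q"
    by (rule mat_inverse_mod_mult_vec_eqI[OF Phi P ab F0],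
        unfold vec_rem_jac_Phi_mult[OF F(1) lam a] top bot vec_rem_append vec_rem_vec) rule
  then show ?thesis
    using carrier_matD(1)[OF Ji] U by (simp add: vec_rem_append vec_rem_vec a_def b_def vec_rem_add)
qed

text \<open>The identity holds modulo \<open>q\<close>, and both sides have degree less than \<open>degree q\<close>, since
  \<open>degree q \<ge> 2\<close> is forced by \<open>\<lambda>\<^sub>1v\<^sub>1 + \<dots> + \<lambda>\<^sub>nv\<^sub>n = T\<close>.\<close>

lemma lincomb_poly_V_bar:
  assumes deg: "\<forall>i<n. degree (v $ i) \<le> degree q - 1"
    and T: "lincomb_poly lam v = var_T"
    and Lambda: "invertible_mod q (Lambda F lam v q)"
  shows "lincomb_poly lam (V_bar F lam v q) = var_T"
proof -
  let ?c = "frac_mod q (Delta F lam v q) (Lambda F lam v q)" and ?U = "U_vec F v q"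
  note U = U_vec_carrier and w = w_vec_carrier
  have "degree (lincomb_poly lam v) \<le> degree q - 1"
    using deg lam by (intro degree_lincomb_poly_le) auto
  then have q2: "degree q \<ge> 2"
    using T by simp
  \<comment> \<open>The correction contributes c Lambda = Delta = lambda . w - T modulo
    \<open>q\<close>, so subtracting it from lambda . w leaves T.\<close>
  have "prem (lincomb_poly lam (vec_rem (?c \<cdot>\<^sub>v ?U) q)) q = prem (?c * Lambda F lam v q) q"
    using prem_lincomb_poly_cong[OF lam, of "vec_rem (?c \<cdot>\<^sub>v ?U) q" "?c \<cdot>\<^sub>v ?U"] U
    by (simp add: lincomb_poly_smult[OF lam U] Lambda_def)
  also have "\<dots> = prem (lincomb_poly lam (w_vec F v q)) q - prem var_T q"
    unfolding prem_frac_mod_mult[OF Lambda] by (simp add: Delta_def prem_diff)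
  finally have cong: "prem (lincomb_poly lam (V_bar F lam v q)) q = prem var_T q"
    using U by (simp add: V_bar_def lincomb_poly_minus[OF lam w] prem_diff)
  \<comment> \<open>Only canonical remainders are subtracted from v_i, so its degree bound
    persists.\<close>
  have "degree (V_bar F lam v q $ i) \<le> degree q - 1" if "i < n" for i
    using that deg v U carrier_matD(1)[OF mat_inverse_mod_jac_carrier]
    by (simp add: V_bar_def w_vec_def)
      (intro degree_diff_le; use degree_prem_le in simp)
  then have "degree (lincomb_poly lam (V_bar F lam v q)) \<le> degree q - 1"
    using lam by (intro degree_lincomb_poly_le) auto
  then show ?thesis
    using cong q2 by (simp add: prem_eq_self)
qed

end

end

text \<open>The vector identity is an equality of polynomials: both sides subtract canonical
  remainders from v and q, and a sum of canonical remainders is again one. The unique existence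
  clause is there because \<open>frac_mod\<close> is a definite description, on which
  \<open>V_bar\<close> and \<open>Q_bar\<close> rest.\<close>

theorem proposition17:
  fixes F :: "'a::euclidean_ring mpoly vec"
    and lam :: "'a vec"
    and v :: "'a poly vec"
    and q :: "'a poly"
    and n d :: nat
  assumes F: "F \<in> carrier_vec n" "\<forall>i<n. mpoly_vars (F $ i) \<subseteq> {..<n}"
    and lam: "lam \<in> carrier_vec n"
    and v: "v \<in> carrier_vec n"
    and c1: "lead_coeff q = 1" "degree q = d"
    and c2: "\<forall>i<n. degree (v $ i) \<le> d - 1"
    and c3: "invertible_mod q (pderiv q)"
    and c4: "lincomb_poly lam v = var_T"
    and c5: "invertible_mat_mod q (jac F v)"
    and c6: "invertible_mat_mod q (jac_Phi F lam v q)"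
  shows "invertible_mod q (Lambda F lam v q) \<and>
    (\<exists>!c. prem c q = c \<and> prem (c * Lambda F lam v q) q = prem (Delta F lam v q) q) \<and>
    V_bar F lam v q @\<^sub>v vec 1 (\<lambda>_. Q_bar F lam v q - monom 1 d) =
      (v @\<^sub>v vec 1 (\<lambda>_. q - monom 1 d))
      - vec_rem (mat_inverse_mod q (jac_Phi F lam v q) *\<^sub>v
          (sys_eval F v @\<^sub>v vec 1 (\<lambda>_. lincomb_poly lam v - var_T))) q \<and>
    vec_rem (sys_eval F v @\<^sub>v vec 1 (\<lambda>_. lincomb_poly lam v - var_T)) q =
      vec_rem (Phi d F lam (v, q - monom 1 d)) q \<and>
    lincomb_poly lam (V_bar F lam v q) = var_T"
proof -
  interpret monic_modulus q
    by unfold_locales (rule c1(1))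
  let ?c = "frac_mod q (Delta F lam v q) (Lambda F lam v q)"
  have Lambda: "invertible_mod q (Lambda F lam v q)"
    by (rule invertible_mod_Lambda[OF F lam v c5 c3 c6])
  have U: "U_vec F v q \<in> carrier_vec n"
    by (rule U_vec_carrier[OF F lam v c5])
  have Ji: "mat_inverse_mod q (jac F v) \<in> carrier_mat n n"
    by (rule mat_inverse_mod_jac_carrier[OF F lam v c5])
  \<comment> \<open>The corrections made in w and in \<open>V_bar\<close> are regrouped into one
    subtracted vector, the form in which the Newton step is known.\<close>
  have "V_bar F lam v q @\<^sub>v vec 1 (\<lambda>_. Q_bar F lam v q - monom 1 d) =
      (v @\<^sub>v vec 1 (\<lambda>_. q - monom 1 d))
      - ((vec_rem (mat_inverse_mod q (jac F v) *\<^sub>v sys_eval F v) q + vec_rem (?c \<cdot>\<^sub>v U_vec F v q) q)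
        @\<^sub>v vec 1 (\<lambda>_. prem (?c * pderiv q) q))"
    using U v carrier_matD(1)[OF Ji]
    by (intro eq_vecI) (auto simp: V_bar_def Q_bar_def w_vec_def append_vec_def Let_def)
  then have "V_bar F lam v q @\<^sub>v vec 1 (\<lambda>_. Q_bar F lam v q - monom 1 d) =
      (v @\<^sub>v vec 1 (\<lambda>_. q - monom 1 d))
      - vec_rem (mat_inverse_mod q (jac_Phi F lam v q) *\<^sub>v
          (sys_eval F v @\<^sub>v vec 1 (\<lambda>_. lincomb_poly lam v - var_T))) q"
    using vec_rem_newton_step[OF F lam v c5 c4 c6 prem_frac_mod_mult[OF Lambda]]
    by (simp add: c4)
  \<comment> \<open>The modulus inside \<open>Phi\<close> is T^d + (q - T^d) = q, and a second
    reduction changes nothing.\<close>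
  moreover have "vec_rem (sys_eval F v @\<^sub>v vec 1 (\<lambda>_. lincomb_poly lam v - var_T)) q =
      vec_rem (Phi d F lam (v, q - monom 1 d)) q"
    by (simp add: Phi_def vec_rem_append)
  moreover have "lincomb_poly lam (V_bar F lam v q) = var_T"
    using c1(2) c2 by (intro lincomb_poly_V_bar[OF F lam v c5 _ c4 Lambda]) auto
  ultimately show ?thesis
    using Lambda frac_mod_unique_exists[OF Lambda] by blast
qed

end
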